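(* Let $a\in(0,1)$, let $\phi_a(z)=az+1-a$, and let $\Theta\in H^2$ be a non-constant inner function. If $\Theta H^2$ is invariant under the composition operator $C_{\phi_a}$, then exactly one of the following occurs: (i) $\Theta(z)=\lambda e^{-K\left(\frac{1+z}{1-z}\right)}$ for some $K>0$ and some $\lambda\in\mathbb{C}$ with $|\lambda|=1$; or (ii) $\Theta$ has infinitely many zeros in $\mathbb{D}$ accumulating at $1$ (that is, $1$ is an accumulation point of the zero set of $\Theta$).
   Context: $H^2$ is the Hardy–Hilbert space of the open unit disk $\mathbb{D}$. For $a\in(0,1)$, $\phi_a(z)=az+1-a$ is a holomorphic self-map of $\mathbb{D}$ and $C_{\phi_a}f=f\circ\phi_a$ is the associated bounded composition operator on $H^2$. An inner function is a function $\Theta\in H^2$ whose radial limits have modulus $1$ almost everywhere on the unit circle. A subspace $M$ is invariant under $C_{\phi_a}$ if $C_{\phi_a}M\subseteq M$. *)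

theory Defs
  imports "HOL-Complex_Analysis.Complex_Analysis"
begin

abbreviation unit_disk :: "complex set" where
  "unit_disk \<equiv> ball 0 1"

text \<open>
  Functions on the disk are represented by total functions on the complex plane whose values
  outside the disk are irrelevant: each set of functions below is closed under changing
  a member outside the disk. The elements of the Hardy--Hilbert space are the functions on the
  disk given by a power series with square-summable coefficients; they are in particular
  holomorphic on the disk.
\<close>

definition hardy2 :: "(complex \<Rightarrow> complex) set" where
  "hardy2 = {f. \<exists>c :: nat \<Rightarrow> complex. summable (\<lambda>n. (norm (c n))\<^sup>2) \<and>
                  (\<forall>z\<in>unit_disk. (\<lambda>n. c n * z ^ n) sums f z)}"

definition inner_function :: "(complex \<Rightarrow> complex) \<Rightarrow> bool" where
  "inner_function \<Theta> \<longleftrightarrow> \<Theta> \<in> hardy2 \<and>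
     (AE t in lborel. t \<in> {0..2 * pi} \<longrightarrow>
        (\<exists>l. ((\<lambda>r::real. \<Theta> (of_real r * cis t)) \<longlongrightarrow> l) (at_left 1) \<and> norm l = 1))"

definition mult_hardy2 :: "(complex \<Rightarrow> complex) \<Rightarrow> (complex \<Rightarrow> complex) set" where
  "mult_hardy2 \<Theta> = {f. \<exists>g\<in>hardy2. \<forall>z\<in>unit_disk. f z = \<Theta> z * g z}"

definition affine_symbol :: "real \<Rightarrow> complex \<Rightarrow> complex" where
  "affine_symbol a z = of_real a * z + 1 - of_real a"

definition composition_op ::
    "(complex \<Rightarrow> complex) \<Rightarrow> (complex \<Rightarrow> complex) \<Rightarrow> (complex \<Rightarrow> complex)" where
  "composition_op \<phi> f = f \<circ> \<phi>"

definition invariant_under ::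
    "((complex \<Rightarrow> complex) \<Rightarrow> (complex \<Rightarrow> complex)) \<Rightarrow> (complex \<Rightarrow> complex) set \<Rightarrow> bool" where
  "invariant_under T M \<longleftrightarrow> T ` M \<subseteq> M"

end

theory Submission
  imports Defs
begin

text \<open>
  Invariance gives \<open>\<Theta> \<circ> \<phi>\<^sub>a = \<Theta> g\<close> with \<open>g \<in> H\<^sup>2\<close>, so the forward orbit under
  \<open>\<phi>\<^sub>a\<close> of a zero consists of zeros, and it converges to 1. If \<open>\<Theta>\<close> has no zeros, then
  the boundary values of \<open>g\<close> show \<open>\<bar>g\<bar> \<le> 1\<close>, that is, \<open>u = - ln \<bar>\<Theta>\<bar>\<close> is a nonnegative
  harmonic function with \<open>u \<le> u \<circ> \<phi>\<^sub>a\<close>. As \<open>\<phi>\<^sub>a\<close> maps the closed disk without 1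
  into the open disk, \<open>u\<close> is bounded away from the point 1. Its radial limits vanish almost
  everywhere, so all the mass of \<open>u\<close> on circles of radius tending to 1 concentrates at 1,
  and \<open>u\<close> is a multiple of the Poisson kernel with pole 1.
\<close>

section \<open>Square means of H^2 functions on circles\<close>

lemma has_integral_cis_int:
  "((\<lambda>t. cis (of_int k * t)) has_integral (if k = 0 then of_real (2 * pi) else 0)) {0..2 * pi}"
proof (cases "k = 0")
  case True
  show ?thesis
    using has_integral_const_real[of "1::complex" 0 "2 * pi"] True by (simp add: scaleR_conv_of_real)
next
  case False
  have "((\<lambda>t. cis (of_int k * t)) has_integral
      cis (of_int k * (2 * pi)) / (\<i> * of_int k) - cis (of_int k * 0) / (\<i> * of_int k)) {0..2 * pi}"
    using False
    unfolding cis_conv_exp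
    by (intro fundamental_theorem_of_calculus)
       (auto intro!: derivative_eq_intros has_vector_derivative_real_field
          [where f = "\<lambda>w. exp (\<i> * (of_int k * w)) / (\<i> * of_int k)"] simp: mult_ac)
  moreover have "cis (of_int k * (2 * pi)) = 1"
    by (metis cis_multiple_2pi Ints_of_int mult.commute mult.left_commute)
  ultimately show ?thesis
    using False by simp
qed

text \<open>Parseval's identity for a polynomial on the circle of radius r: after expanding the
  square as a double sum, orthogonality of the characters leaves only the diagonal.\<close>

lemma has_integral_norm_polynomial_square:
  fixes c :: "nat \<Rightarrow> complex" and r :: real
  shows "((\<lambda>t. (norm (\<Sum>n<N. c n * (of_real r * cis t) ^ n))\<^sup>2) has_integral
           2 * pi * (\<Sum>n<N. (norm (c n) * r ^ n)\<^sup>2)) {0..2 * pi}"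
proof -
  let ?x = "\<lambda>t n. c n * (of_real r * cis t) ^ n"
  let ?b = "\<lambda>n m. c n * cnj (c m) * of_real (r ^ n * r ^ m)"
  have x: "?x t n * cnj (?x t m) = ?b n m * cis (of_int (int n - int m) * t)" for t n m
  proof -
    have "cis (of_int (int n - int m) * t) = cis t ^ n * cnj (cis t) ^ m"
      unfolding cis_cnj Complex.DeMoivre cis_mult by (simp add: algebra_simps)
    then show ?thesis
      by (simp add: power_mult_distrib)
  qed
  have sq: "of_real ((norm (\<Sum>n<N. ?x t n))\<^sup>2)
      = (\<Sum>n<N. \<Sum>m<N. ?b n m * cis (of_int (int n - int m) * t))" for t
    unfolding complex_norm_square cnj_sum sum_product x ..
  have "((\<lambda>t. \<Sum>n<N. \<Sum>m<N. ?b n m * cis (of_int (int n - int m) * t)) has_integral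
      (\<Sum>n<N. \<Sum>m<N. ?b n m * (if int n - int m = 0 then of_real (2 * pi) else 0))) {0..2 * pi}"
    by (intro has_integral_sum has_integral_mult_right has_integral_cis_int) auto
  also have "(\<Sum>n<N. \<Sum>m<N. ?b n m * (if int n - int m = 0 then of_real (2 * pi) else 0))
      = (\<Sum>n<N. of_real (2 * pi) * ?b n n)"
    by (intro sum.cong refl) (simp add: if_distrib cong: if_cong)
  also have "\<dots> = (\<Sum>n<N. of_real (2 * pi) * of_real ((norm (c n) * r ^ n)\<^sup>2))"
    by (simp only: power_mult_distrib of_real_mult complex_norm_square power2_eq_square[of "r ^ _"] mult_ac)
  also have "\<dots> = of_real (2 * pi * (\<Sum>n<N. (norm (c n) * r ^ n)\<^sup>2))"
    by (simp add: sum_distrib_left)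
  finally have "((\<lambda>t. of_real ((norm (\<Sum>n<N. ?x t n))\<^sup>2)) has_integral
      complex_of_real (2 * pi * (\<Sum>n<N. (norm (c n) * r ^ n)\<^sup>2))) {0..2 * pi}"
    unfolding sq .
  from has_integral_Re[OF this] show ?thesis
    by simp
qed

lemma norm_of_real_cis [simp]: "norm (of_real r * cis t) = \<bar>r\<bar>"
  by (simp add: norm_mult)

lemma continuous_on_circle:
  fixes f :: "complex \<Rightarrow> 'a::topological_space"
  assumes "continuous_on unit_disk f" "0 \<le> r" "r < 1"
  shows "continuous_on A (\<lambda>t. f (of_real r * cis t))"
  by (rule continuous_on_compose2[OF assms(1)]) (use assms in \<open>auto intro!: continuous_intros\<close>)

lemma hardy2_holomorphic:
  assumes "f \<in> hardy2"
  shows "f holomorphic_on unit_disk"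
proof -
  obtain c where "\<forall>z\<in>unit_disk. (\<lambda>n. c n * z ^ n) sums f z"
    using assms unfolding hardy2_def by blast
  then show ?thesis
    by (intro power_series_holomorphic[of 0 1 c]) auto
qed

text \<open>Parseval's identity bounds the square means of the partial sums by 2 pi times the sum of
  the squared coefficients, independently of r. For fixed r < 1 the partial sums are bounded on the
  circle, so dominated convergence carries the bound to \<open>f\<close>.\<close>

lemma hardy2_square_mean_bounded:
  assumes "f \<in> hardy2"
  obtains C where "\<And>r. 0 \<le> r \<Longrightarrow> r < 1 \<Longrightarrow>
    integral {0..2 * pi} (\<lambda>t. (norm (f (of_real r * cis t)))\<^sup>2) \<le> C"
proof -
  obtain c where c: "summable (\<lambda>n. (norm (c n))\<^sup>2)"
    and f: "\<And>z. z \<in> unit_disk \<Longrightarrow> (\<lambda>n. c n * z ^ n) sums f z"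
    using assms unfolding hardy2_def by blast
  show thesis
  proof (rule that)
    fix r :: real
    assume r: "0 \<le> r" "r < 1"
    let ?p = "\<lambda>N t. \<Sum>n<N. c n * (of_real r * cis t) ^ n"
    have rn: "summable (\<lambda>n. norm (c n) * r ^ n)"
    proof -
      \<comment> \<open>A radius strictly between r and 1: convergence of the power series at s
        gives absolute convergence at r.\<close>
      define s where "s = (1 + r) / 2"
      have s: "r < s" "s < 1" "0 < s"
        using r by (auto simp: s_def)
      have "summable (\<lambda>n. c n * of_real s ^ n)"
        using f[of "of_real s"] s by (auto simp: sums_iff)
      from powser_insidea[OF this, of "of_real r"] show ?thesis
        using r s by (simp add: norm_mult norm_power)
    qed
    have "(\<lambda>N. integral {0..2 * pi} (\<lambda>t. (norm (?p N t))\<^sup>2))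
        \<longlonglongrightarrow> integral {0..2 * pi} (\<lambda>t. (norm (f (of_real r * cis t)))\<^sup>2)"
    proof (rule dominated_convergence(2)[where h = "\<lambda>_. (\<Sum>n. norm (c n) * r ^ n)\<^sup>2"])
      show "(\<lambda>t. (norm (?p N t))\<^sup>2) integrable_on {0..2 * pi}" for N
        using has_integral_norm_polynomial_square by blast
      fix t :: real
      have "norm (?p N t) \<le> (\<Sum>n. norm (c n) * r ^ n)" for N
      proof -
        have "norm (?p N t) \<le> (\<Sum>n<N. norm (c n) * r ^ n)"
          by (intro sum_norm_le) (use r in \<open>simp add: norm_mult norm_power\<close>)
        also have "\<dots> \<le> (\<Sum>n. norm (c n) * r ^ n)"
          by (intro sum_le_suminf rn) (use r in auto)
        finally show ?thesis .
      qed
      then show "norm ((norm (?p N t))\<^sup>2) \<le> (\<Sum>n. norm (c n) * r ^ n)\<^sup>2" for N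
        by (simp add: power_mono)
      have "of_real r * cis t \<in> unit_disk"
        using r by simp
      from f[OF this] show "(\<lambda>N. (norm (?p N t))\<^sup>2) \<longlonglongrightarrow> (norm (f (of_real r * cis t)))\<^sup>2"
        unfolding sums_def by (intro tendsto_intros)
    qed auto
    moreover have "integral {0..2 * pi} (\<lambda>t. (norm (?p N t))\<^sup>2) \<le> 2 * pi * (\<Sum>n. (norm (c n))\<^sup>2)" for N
    proof -
      have "integral {0..2 * pi} (\<lambda>t. (norm (?p N t))\<^sup>2) = 2 * pi * (\<Sum>n<N. (norm (c n) * r ^ n)\<^sup>2)"
        using has_integral_norm_polynomial_square by (rule integral_unique)
      also have "(\<Sum>n<N. (norm (c n) * r ^ n)\<^sup>2) \<le> (\<Sum>n<N. (norm (c n))\<^sup>2)"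
        using r by (intro sum_mono power_mono mult_left_le power_le_one) auto
      also have "\<dots> \<le> (\<Sum>n. (norm (c n))\<^sup>2)"
        by (intro sum_le_suminf c) auto
      finally show ?thesis
        by simp
    qed
    ultimately show "integral {0..2 * pi} (\<lambda>t. (norm (f (of_real r * cis t)))\<^sup>2)
        \<le> 2 * pi * (\<Sum>n. (norm (c n))\<^sup>2)"
      by (intro LIMSEQ_le_const2) auto
  qed
qed

section \<open>The Poisson kernel and the Poisson formula\<close>

definition poisson_kernel :: "complex \<Rightarrow> complex \<Rightarrow> real" where
  "poisson_kernel z w = (1 - (norm z)\<^sup>2) / (norm (w - z))\<^sup>2"

text \<open>This is Cauchy's integral formula at z for the function f(r w) times (1 - |z|^2) / (1 -
  cnj z w). The extra factor is holomorphic on the closed disk and equals 1 at w = z, and on the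
  unit circle it turns the Cauchy kernel into the Poisson kernel. The dilation by r makes boundary
  values of \<open>f\<close> unnecessary. The kernel carries no factor 1 / (2 pi), hence the
  constant on the right.\<close>

lemma poisson_formula:
  assumes f: "f holomorphic_on unit_disk" and r: "0 \<le> r" "r < 1" and z: "z \<in> unit_disk"
  shows "((\<lambda>t. f (of_real r * cis t) * of_real (poisson_kernel z (cis t))) has_integral
            of_real (2 * pi) * f (of_real r * z)) {0..2 * pi}"
proof -
  define F where "F = (\<lambda>w. f (of_real r * w) * (of_real (1 - (norm z)\<^sup>2) / (1 - cnj z * w)))"
  have nz: "1 - cnj z * w \<noteq> 0" if "norm w \<le> 1" for w
  proof
    assume "1 - cnj z * w = 0"
    then have "norm z * norm w = 1"
      by (metis complex_mod_cnj eq_iff_diff_eq_0 norm_mult norm_one)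
    moreover have "norm z * norm w \<le> norm z"
      using that by (simp add: mult_left_le)
    ultimately show False
      using z by simp
  qed
  have "(\<lambda>w. f (of_real r * w)) holomorphic_on cball 0 1"
  proof (rule holomorphic_on_compose_gen[OF _ f, unfolded o_def])
    show "(*) (of_real r) ` cball 0 1 \<subseteq> unit_disk"
    proof clarify
      fix w :: complex
      assume "w \<in> cball 0 1"
      then have "r * norm w \<le> r"
        using r by (simp add: mult_left_le)
      then show "of_real r * w \<in> unit_disk"
        using r by (simp add: norm_mult)
    qed
  qed (intro holomorphic_intros)
  then have "F holomorphic_on cball 0 1"
    unfolding F_def using nz by (intro holomorphic_intros) auto
  from Cauchy_integral_circlepath_simple[OF this, of z]
  have "((\<lambda>u. F u / (u - z)) has_contour_integral (2 * of_real pi * \<i> * F z)) (part_circlepath 0 1 0 (2 * pi))"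
    using z by (simp add: circlepath_def)
  then have *: "((\<lambda>t. F (cis t) / (cis t - z) * \<i> * cis t) has_integral (2 * of_real pi * \<i> * F z)) {0..2 * pi}"
    by (simp add: has_contour_integral_part_circlepath_iff)
  have "complex_of_real (1 - (norm z)\<^sup>2) = 1 - cnj z * z"
    by (simp only: of_real_diff of_real_1 complex_norm_square mult.commute)
  then have "F z = f (of_real r * z)"
    using nz[of z] z unfolding F_def by simp
  moreover have "F (cis t) / (cis t - z) * \<i> * cis t
      = \<i> * (f (of_real r * cis t) * of_real (poisson_kernel z (cis t)))" for t
  proof -
    \<comment> \<open>On the unit circle cnj w = 1 / w, so |w - z|^2 = (w - z) (1 - cnj z w) /
      w.\<close>
    have e: "of_real ((norm (cis t - z))\<^sup>2) = (cis t - z) * ((1 - cnj z * cis t) / cis t)"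
      unfolding complex_norm_square
      by (simp add: cis_cnj field_simps flip: cis_inverse)
    have "cis t \<noteq> z"
      using z by auto
    then show ?thesis
      unfolding F_def poisson_kernel_def of_real_divide e
      by (simp add: divide_simps)
  qed
  ultimately have "((\<lambda>t. \<i> * (f (of_real r * cis t) * of_real (poisson_kernel z (cis t)))) has_integral
      (2 * of_real pi * \<i> * f (of_real r * z))) {0..2 * pi}"
    using * by simp
  from has_integral_mult_right[OF this, of "- \<i>"] show ?thesis
    by (simp add: mult_ac)
qed

lemma poisson_kernel_nonneg: "z \<in> unit_disk \<Longrightarrow> 0 \<le> poisson_kernel z w"
  by (simp add: poisson_kernel_def power_le_one)

lemma continuous_on_poisson_kernel:
  assumes "z \<in> unit_disk"
  shows "continuous_on A (\<lambda>t. poisson_kernel z (cis t))"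
proof -
  have "cis t \<noteq> z" for t
    using assms by auto
  then show ?thesis
    unfolding poisson_kernel_def by (intro continuous_intros) auto
qed

lemma integral_poisson_kernel:
  assumes "z \<in> unit_disk"
  shows "integral {0..2 * pi} (\<lambda>t. poisson_kernel z (cis t)) = 2 * pi"
  using has_integral_Re[OF poisson_formula[of "\<lambda>_. 1" 0 z]] assms by (simp add: integral_unique)

section \<open>Limits of integrals over circles of radius tending to 1\<close>

lemma integral_bounded_tendsto_0:
  fixes F :: "nat \<Rightarrow> real \<Rightarrow> real"
  assumes cont: "\<And>n. continuous_on {a..b} (F n)"
    and bound: "\<And>n t. t \<in> {a..b} \<Longrightarrow> \<bar>F n t\<bar> \<le> B"
    and lim: "AE t in lborel. t \<in> {a..b} \<longrightarrow> (\<lambda>n. F n t) \<longlonglongrightarrow> 0"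
  shows "(\<lambda>n. integral {a..b} (F n)) \<longlonglongrightarrow> 0"
proof -
  have int: "set_integrable lborel {a..b} (F n)" for n
    by (rule borel_integrable_atLeastAtMost'[OF cont])
  \<comment> \<open>Radial limits are controlled only almost everywhere, so the limit is taken for
    Lebesgue integrals, with measurability coming from continuity, and is then carried back to the
    gauge integral.\<close>
  have "(\<lambda>n. LINT t|lborel. indicator {a..b} t *\<^sub>R F n t) \<longlonglongrightarrow> (LINT t|(lborel :: real measure). (0::real))"
  proof (rule integral_dominated_convergence[where w = "\<lambda>t. indicator {a..b} t *\<^sub>R B"])
    show "integrable lborel (\<lambda>t. indicator {a..b} t *\<^sub>R B)"
      by (fold set_integrable_def, rule borel_integrable_atLeastAtMost') auto
    show "(\<lambda>t. indicator {a..b} t *\<^sub>R F n t) \<in> borel_measurable lborel" for n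
      using int[of n] unfolding set_integrable_def by (rule borel_measurable_integrable)
    show "AE t in lborel. (\<lambda>n. indicator {a..b} t *\<^sub>R F n t) \<longlonglongrightarrow> 0"
      using lim by eventually_elim (auto split: split_indicator)
    show "AE t in lborel. norm (indicator {a..b} t *\<^sub>R F n t) \<le> indicator {a..b} t *\<^sub>R B" for n
      using bound by (auto split: split_indicator)
  qed auto
  then show ?thesis
    using set_borel_integral_eq_integral(2)[OF int] by (simp add: set_lebesgue_integral_def)
qed

text \<open>One fixed sequence in [0, 1) tending to 1; bounded convergence is applied along it in
  place of the continuous radial limit.\<close>

definition radii :: "nat \<Rightarrow> real" where
  "radii n = 1 - inverse (real (Suc n))"

lemma radii_bounds: "0 \<le> radii n" "radii n < 1"
  by (auto simp: radii_def divide_simps)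

lemma filterlim_radii: "filterlim radii (at_left 1) sequentially"
proof -
  have "radii \<longlonglongrightarrow> 1 - 0"
    unfolding radii_def by (intro tendsto_intros LIMSEQ_inverse_real_of_nat)
  then show ?thesis
    using radii_bounds(2) by (auto simp: filterlim_at less_le intro!: always_eventually)
qed

lemma tendsto_radii_mult:
  assumes "f holomorphic_on unit_disk" "z \<in> unit_disk"
  shows "(\<lambda>n. f (of_real (radii n) * z)) \<longlonglongrightarrow> f z"
proof -
  have "isCont f z"
    using assms by (meson continuous_on_eq_continuous_at holomorphic_on_imp_continuous_on open_ball)
  moreover have "(\<lambda>n. of_real (radii n) * z) \<longlonglongrightarrow> of_real 1 * z"
    using filterlim_radii by (intro tendsto_intros) (simp add: filterlim_at)
  ultimately show ?thesis
    using isCont_tendsto_compose by fastforce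
qed

text \<open>Serves for a second limit, in a truncation level or an error bound, after the radius has
  gone to 1.\<close>

lemma le_by_inverse_Suc:
  fixes x y D :: real
  assumes "\<And>N. x \<le> y + D * inverse (real (Suc N))"
  shows "x \<le> y"
proof (rule LIMSEQ_le_const)
  show "(\<lambda>N. y + D * inverse (real (Suc N))) \<longlonglongrightarrow> y"
    using tendsto_add[OF tendsto_const tendsto_mult_left[OF LIMSEQ_inverse_real_of_nat]] by auto
qed (use assms in blast)

lemma poisson_kernel_bounded:
  assumes "z \<in> unit_disk"
  obtains B where "\<And>t. t \<in> {0..2 * pi} \<Longrightarrow> poisson_kernel z (cis t) \<le> B"
proof -
  have "compact ((\<lambda>t. poisson_kernel z (cis t)) ` {0..2 * pi})"
    by (intro compact_continuous_image continuous_on_poisson_kernel assms) auto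
  then show ?thesis
    by (meson that bounded_has_Sup(1) compact_imp_bounded bdd_above.E bounded_imp_bdd_above imageI)
qed

text \<open>
  Pointwise \<open>\<bar>f\<bar> \<le> 1 + max 0 (min \<bar>f\<bar> M - 1) + \<bar>f\<bar>\<^sup>2 / M\<close>. Integrated against the Poisson kernel
  on circles of radius tending to 1, the second term vanishes by bounded convergence and
  the third is \<open>O(1/M)\<close> by the bound on the square means.
\<close>
lemma hardy2_norm_le_1:
  assumes f: "f \<in> hardy2"
    and lim: "AE t in lborel. t \<in> {0..2 * pi} \<longrightarrow>
      (\<exists>l\<le>1. ((\<lambda>r::real. norm (f (of_real r * cis t))) \<longlongrightarrow> l) (at_left 1))"
    and z: "z \<in> unit_disk"
  shows "norm (f z) \<le> 1"
proof -
  let ?I = "{0..2 * pi}"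
  let ?P = "\<lambda>t. poisson_kernel z (cis t)"
  let ?f = "\<lambda>n t. norm (f (of_real (radii n) * cis t))"
  note hol = hardy2_holomorphic[OF f]
  obtain C where C: "\<And>r. 0 \<le> r \<Longrightarrow> r < 1 \<Longrightarrow> integral ?I (\<lambda>t. (norm (f (of_real r * cis t)))\<^sup>2) \<le> C"
    using hardy2_square_mean_bounded[OF f] by blast
  obtain B where B: "\<And>t. t \<in> ?I \<Longrightarrow> ?P t \<le> B"
    using poisson_kernel_bounded[OF z] by blast
  have B0: "0 \<le> B"
    using poisson_kernel_nonneg[OF z] B[of 0] by (meson atLeastAtMost_iff order_refl order_trans pi_ge_zero zero_le_mult_iff zero_le_numeral)
  have cf: "continuous_on ?I (?f n)" for n
    by (intro continuous_on_norm continuous_on_circle radii_bounds holomorphic_on_imp_continuous_on hol)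
  note cont = cf continuous_on_poisson_kernel[OF z]
  have bound: "2 * pi * norm (f z) \<le> 2 * pi + B * C * inverse (real (Suc N))" for N
  proof -
    define M where "M = real (Suc N)"
    have M: "0 < M" by (simp add: M_def)
    define F where "F n t = max 0 (min (?f n t) M - 1) * ?P t" for n t
    have cF: "continuous_on ?I (F n)" for n
      unfolding F_def by (intro continuous_intros cont)
    have F0: "(\<lambda>n. integral ?I (F n)) \<longlonglongrightarrow> 0"
    proof (rule integral_bounded_tendsto_0[OF cF])
      show "\<bar>F n t\<bar> \<le> M * B" if "t \<in> ?I" for n t
        using B[OF that] poisson_kernel_nonneg[OF z, of "cis t"] M
        by (auto simp: F_def abs_mult intro!: mult_mono)
      show "AE t in lborel. t \<in> ?I \<longrightarrow> (\<lambda>n. F n t) \<longlonglongrightarrow> 0"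
        using lim
      proof eventually_elim
        case (elim t)
        show ?case
        proof
          assume "t \<in> ?I"
          then obtain l where l: "l \<le> 1" "((\<lambda>r::real. norm (f (of_real r * cis t))) \<longlongrightarrow> l) (at_left 1)"
            using elim by blast
          have "(\<lambda>n. F n t) \<longlonglongrightarrow> max 0 (min l M - 1) * ?P t"
            unfolding F_def by (intro tendsto_intros filterlim_compose[OF l(2) filterlim_radii])
          then show "(\<lambda>n. F n t) \<longlonglongrightarrow> 0"
            using l(1) by (simp add: max_def min_def split: if_splits)
        qed
      qed
    qed
    have "2 * pi * norm (f (of_real (radii n) * z)) \<le> 2 * pi + integral ?I (F n) + B * C * inverse M" for n
    proof -
      have int: "?P integrable_on ?I" "F n integrable_on ?I" "(\<lambda>t. (?f n t)\<^sup>2) integrable_on ?I"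
          "(\<lambda>t. ?f n t * ?P t) integrable_on ?I"
        by (intro integrable_continuous_interval continuous_intros cont cF)+
      have "2 * pi * norm (f (of_real (radii n) * z))
          = norm (integral ?I (\<lambda>t. f (of_real (radii n) * cis t) * of_real (?P t)))"
        using poisson_formula[OF hol radii_bounds z, of n] by (simp add: integral_unique norm_mult)
      also have "\<dots> \<le> integral ?I (\<lambda>t. ?f n t * ?P t)"
        using poisson_formula[OF hol radii_bounds z, of n] int(4) poisson_kernel_nonneg[OF z]
        by (intro integral_norm_bound_integral) (auto simp: norm_mult)
      also have "\<dots> \<le> integral ?I (\<lambda>t. ?P t + F n t + B * inverse M * (?f n t)\<^sup>2)"
      proof (intro integral_le integrable_add int integrable_on_mult_right)
        fix t assume t: "t \<in> ?I"
        define y where "y = ?f n t"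
        have "y \<le> 1 + max 0 (min y M - 1) + inverse M * y\<^sup>2"
        proof (cases "y \<le> M")
          case True
          moreover have "0 \<le> inverse M * y\<^sup>2"
            using M by simp
          ultimately show ?thesis
            by linarith
        next
          case False
          \<comment> \<open>Above the truncation level the quadratic term alone dominates y.\<close>
          then have "y * M \<le> y * y"
            using M by (intro mult_left_mono) auto
          then have "y \<le> inverse M * y\<^sup>2"
            using M by (simp add: field_simps power2_eq_square)
          then show ?thesis by linarith
        qed
        then have "y * ?P t \<le> (1 + max 0 (min y M - 1) + inverse M * y\<^sup>2) * ?P t"
          using poisson_kernel_nonneg[OF z] by (rule mult_right_mono)
        \<comment> \<open>Only the quadratic term gives up the kernel for its bound B; the constant
          term must keep it in order to integrate to exactly 2 pi.\<close>
        also have "\<dots> \<le> ?P t + F n t + inverse M * y\<^sup>2 * B"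
          using mult_left_mono[OF B[OF t], of "inverse M * y\<^sup>2"] M
          by (simp add: F_def y_def algebra_simps)
        finally show "?f n t * ?P t \<le> ?P t + F n t + B * inverse M * (?f n t)\<^sup>2"
          by (simp add: y_def mult_ac)
      qed
      also have "\<dots> = 2 * pi + integral ?I (F n) + B * inverse M * integral ?I (\<lambda>t. (?f n t)\<^sup>2)"
        using int by (simp add: integral_add integrable_add integrable_on_mult_right integral_poisson_kernel[OF z])
      also have "\<dots> \<le> 2 * pi + integral ?I (F n) + B * inverse M * C"
        using C[OF radii_bounds] B0 M by (intro add_left_mono mult_left_mono) auto
      finally show ?thesis
        by (simp add: mult_ac)
    qed
    note le = this
    have lhs: "(\<lambda>n. 2 * pi * norm (f (of_real (radii n) * z))) \<longlonglongrightarrow> 2 * pi * norm (f z)"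
      by (intro tendsto_intros tendsto_radii_mult hol z)
    have rhs: "(\<lambda>n. 2 * pi + integral ?I (F n) + B * C * inverse M) \<longlonglongrightarrow> 2 * pi + 0 + B * C * inverse M"
      by (intro tendsto_intros F0)
    from LIMSEQ_le[OF lhs rhs] le show ?thesis
      by (auto simp: M_def)
  qed
  from le_by_inverse_Suc[OF this] show ?thesis
    by simp
qed

text \<open>A Herglotz representation with a single point mass, obtained without weak limits of
  measures. By the mean value property, Re h has the same total mass on every circle. Away from 1 it
  is bounded and has radial limit 0 almost everywhere, so its mass there tends to 0. Integrating the
  continuous function t -> P(z, cis t) against it therefore yields, in the limit, the value of this
  function at the point 1 times the mass.\<close>

lemma vanishing_off_1_imp_poisson_kernel:
  assumes h: "h holomorphic_on unit_disk" and z: "z \<in> unit_disk"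
    and nonneg: "\<And>w. w \<in> unit_disk \<Longrightarrow> 0 \<le> Re (h w)"
    and bound: "\<And>\<delta>. 0 < \<delta> \<Longrightarrow> \<exists>B. \<forall>w\<in>unit_disk. \<delta> \<le> norm (w - 1) \<longrightarrow> Re (h w) \<le> B"
    and lim: "AE t in lborel. t \<in> {0..2 * pi} \<longrightarrow>
      ((\<lambda>r::real. Re (h (of_real r * cis t))) \<longlongrightarrow> 0) (at_left 1)"
  shows "Re (h z) = Re (h 0) * poisson_kernel z 1"
proof -
  let ?I = "{0..2 * pi}"
  let ?u = "\<lambda>n t. Re (h (of_real (radii n) * cis t))"
  define Q where "Q t = poisson_kernel z (cis t) - poisson_kernel z 1" for t
  have cQ: "continuous_on ?I Q"
    unfolding Q_def by (intro continuous_intros continuous_on_poisson_kernel z)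
  have cu: "continuous_on ?I (?u n)" for n
    by (intro continuous_intros continuous_on_circle radii_bounds holomorphic_on_imp_continuous_on h)
  have disk: "of_real (radii n) * cis t \<in> unit_disk" for n t
    using radii_bounds[of n] by simp
  have Pu: "((\<lambda>t. ?u n t * poisson_kernel w (cis t)) has_integral 2 * pi * Re (h (of_real (radii n) * w))) ?I"
    if "w \<in> unit_disk" for n w
    using has_integral_Re[OF poisson_formula[OF h radii_bounds that, of n]] by simp
  have mean: "(?u n has_integral 2 * pi * Re (h 0)) ?I" for n
    using Pu[of 0 n] by (simp add: poisson_kernel_def)
  have "bounded (Q ` ?I)"
    by (intro compact_imp_bounded compact_continuous_image cQ) auto
  then obtain D where D: "\<And>t. t \<in> ?I \<Longrightarrow> \<bar>Q t\<bar> \<le> D"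
    unfolding bounded_iff by fastforce
  \<comment> \<open>The leading \<open>0 +\<close> supplies the shape
    \<open>y + D * inverse (real (Suc N))\<close> that \<open>le_by_inverse_Suc\<close>
    expects.\<close>
  have "2 * pi * \<bar>Re (h z) - Re (h 0) * poisson_kernel z 1\<bar>
      \<le> 0 + 2 * pi * Re (h 0) * inverse (real (Suc N))" for N
  proof -
    define \<epsilon> where "\<epsilon> = inverse (real (Suc N))"
    have \<epsilon>: "0 < \<epsilon>" by (simp add: \<epsilon>_def)
    have "isCont (poisson_kernel z) 1"
      using z unfolding poisson_kernel_def by (intro continuous_intros) auto
    then obtain \<delta> where \<delta>: "0 < \<delta>"
      and close: "\<And>w. norm (w - 1) < \<delta> \<Longrightarrow> \<bar>poisson_kernel z w - poisson_kernel z 1\<bar> < \<epsilon>"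
      using \<epsilon> unfolding continuous_at_eps_delta dist_norm by auto
    obtain B where B: "\<And>w. w \<in> unit_disk \<Longrightarrow> \<delta> / 2 \<le> norm (w - 1) \<Longrightarrow> Re (h w) \<le> B"
      using bound[OF half_gt_zero[OF \<delta>]] by blast
    \<comment> \<open>The excess of |Q| over \<epsilon> vanishes for cis t within \<delta> of 1, so
      \<open>G\<close> sees Re h only where it is bounded.\<close>
    define G where "G n t = ?u n t * max 0 (\<bar>Q t\<bar> - \<epsilon>)" for n t
    have cG: "continuous_on ?I (G n)" for n
      unfolding G_def by (intro continuous_intros cu cQ)
    have G0: "(\<lambda>n. integral ?I (G n)) \<longlonglongrightarrow> 0"
    proof (rule integral_bounded_tendsto_0[OF cG])
      fix n t assume t: "t \<in> ?I"
      have D0: "0 \<le> D"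
        using D[OF t] by linarith
      show "\<bar>G n t\<bar> \<le> \<bar>B\<bar> * D"
      proof (cases "norm (cis t - 1) < \<delta>")
        case True
        then show ?thesis
          using close[OF True] D0 by (simp add: G_def Q_def)
      next
        case False
        let ?w = "of_real (radii n) * cis t"
        \<comment> \<open>The point \<open>?w\<close> is at least as far from 1 as from cis t. By
          the triangle inequality, moving from cis t to \<open>?w\<close> at most halves the
          distance to 1, which is why \<open>B\<close> was chosen for \<delta> / 2.\<close>
        have "norm (cis t - ?w) = 1 - radii n"
        proof -
          have "cis t - ?w = of_real (1 - radii n) * cis t"
            by (simp add: algebra_simps)
          then show ?thesis
            using radii_bounds[of n] by (simp only: norm_of_real_cis)
        qed
        moreover have "1 - radii n \<le> norm (?w - 1)"
          using norm_triangle_ineq2[of 1 ?w] radii_bounds[of n] by (simp add: norm_minus_commute)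
        ultimately have "\<delta> / 2 \<le> norm (?w - 1)"
          using norm_triangle_ineq[of "cis t - ?w" "?w - 1"] False by simp
        from B[OF disk this] nonneg[OF disk, of n t] show ?thesis
          using D[OF t] \<epsilon> by (auto simp: G_def abs_mult intro!: mult_mono)
      qed
    next
      show "AE t in lborel. t \<in> ?I \<longrightarrow> (\<lambda>n. G n t) \<longlonglongrightarrow> 0"
        using lim
      proof eventually_elim
        case (elim t)
        then show ?case
          unfolding G_def by (auto intro!: tendsto_mult_left_zero filterlim_compose[OF _ filterlim_radii])
      qed
    qed
    have "2 * pi * \<bar>Re (h (of_real (radii n) * z)) - Re (h 0) * poisson_kernel z 1\<bar>
        \<le> 2 * pi * Re (h 0) * \<epsilon> + integral ?I (G n)" for n
    proof -
      have "((\<lambda>t. ?u n t * poisson_kernel z (cis t) - ?u n t * poisson_kernel z 1) has_integral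
          2 * pi * Re (h (of_real (radii n) * z)) - 2 * pi * Re (h 0) * poisson_kernel z 1) ?I"
        by (intro has_integral_diff Pu z has_integral_mult_left mean)
      then have uQ: "((\<lambda>t. ?u n t * Q t) has_integral
          2 * pi * (Re (h (of_real (radii n) * z)) - Re (h 0) * poisson_kernel z 1)) ?I"
        by (simp add: Q_def algebra_simps)
      have "2 * pi * \<bar>Re (h (of_real (radii n) * z)) - Re (h 0) * poisson_kernel z 1\<bar>
          = norm (integral ?I (\<lambda>t. ?u n t * Q t))"
        using integral_unique[OF uQ] by (simp add: abs_mult)
      also have "\<dots> \<le> integral ?I (\<lambda>t. ?u n t * \<epsilon> + G n t)"
      proof (rule integral_norm_bound_integral)
        show "(\<lambda>t. ?u n t * Q t) integrable_on ?I"
          using uQ by blast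
        show "(\<lambda>t. ?u n t * \<epsilon> + G n t) integrable_on ?I"
          by (intro integrable_continuous_interval continuous_intros cu cG)
        show "norm (?u n t * Q t) \<le> ?u n t * \<epsilon> + G n t" for t
        proof -
          have "?u n t * \<bar>Q t\<bar> \<le> ?u n t * (\<epsilon> + max 0 (\<bar>Q t\<bar> - \<epsilon>))"
            by (intro mult_left_mono nonneg disk) auto
          then show ?thesis
            using nonneg[OF disk, of n t] by (simp add: G_def abs_mult distrib_left)
        qed
      qed
      also have "\<dots> = 2 * pi * Re (h 0) * \<epsilon> + integral ?I (G n)"
        by (intro integral_unique has_integral_add has_integral_mult_left mean
            integrable_integral integrable_continuous_interval cG)
      finally show ?thesis .
    qed
    note le = this
    have lhs: "(\<lambda>n. 2 * pi * \<bar>Re (h (of_real (radii n) * z)) - Re (h 0) * poisson_kernel z 1\<bar>)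
        \<longlonglongrightarrow> 2 * pi * \<bar>Re (h z) - Re (h 0) * poisson_kernel z 1\<bar>"
      by (intro tendsto_intros tendsto_radii_mult h z)
    have rhs: "(\<lambda>n. 2 * pi * Re (h 0) * \<epsilon> + integral ?I (G n)) \<longlonglongrightarrow> 2 * pi * Re (h 0) * \<epsilon> + 0"
      by (intro tendsto_intros G0)
    from LIMSEQ_le[OF lhs rhs] le show ?thesis
      by (auto simp: \<epsilon>_def)
  qed
  from le_by_inverse_Suc[OF this] show ?thesis
    using pi_gt_zero by (auto simp: mult_le_0_iff)
qed

section \<open>The affine symbol and the boundary point 1\<close>

lemma affine_symbol_in_disk:
  assumes a: "0 < a" "a < 1" and w: "norm w \<le> 1" "w \<noteq> 1"
  shows "affine_symbol a w \<in> unit_disk"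
proof -
  have w2: "(Re w)\<^sup>2 + (Im w)\<^sup>2 \<le> 1"
    using w(1) by (simp add: cmod_def)
  have "Re w < 1"
  proof (rule ccontr)
    assume "\<not> Re w < 1"
    then have "Re w = 1"
      using complex_Re_le_cmod[of w] w(1) by linarith
    then show False
      using w2 w(2) by (simp add: complex_eq_iff)
  qed
  \<comment> \<open>The image is a convex combination of w and 1. Strictness comes from the cross
    term, through Re w < 1.\<close>
  have "(norm (affine_symbol a w))\<^sup>2 = a\<^sup>2 * ((Re w)\<^sup>2 + (Im w)\<^sup>2) + 2 * a * (1 - a) * Re w + (1 - a)\<^sup>2"
    unfolding cmod_power2 by (simp add: affine_symbol_def algebra_simps power2_eq_square)
  also have "\<dots> < a\<^sup>2 * 1 + 2 * a * (1 - a) * 1 + (1 - a)\<^sup>2"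
    using a w2 \<open>Re w < 1\<close>
    by (intro add_strict_right_mono add_le_less_mono mult_left_mono mult_strict_left_mono) auto
  also have "\<dots> = 1\<^sup>2"
    by (simp add: algebra_simps power2_eq_square)
  finally show ?thesis
    by (metis mem_ball_0 power_less_imp_less_base zero_le_one)
qed

lemma one_minus_affine_symbol_funpow:
  "1 - (affine_symbol a ^^ n) z = of_real a ^ n * (1 - z)"
proof (induction n)
  case (Suc n)
  have "1 - (affine_symbol a ^^ Suc n) z = of_real a * (1 - (affine_symbol a ^^ n) z)"
    by (simp add: affine_symbol_def algebra_simps)
  then show ?case
    by (simp only: Suc) simp
qed simp

text \<open>The witness is the forward orbit of z, which approaches 1 geometrically. It stays in the
  open disk and so never equals its limit.\<close>

lemma islimpt_zeros:
  assumes a: "0 < a" "a < 1"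
    and inv: "\<And>z. z \<in> unit_disk \<Longrightarrow> f z = 0 \<Longrightarrow> f (affine_symbol a z) = 0"
    and z: "z \<in> unit_disk" "f z = 0"
  shows "1 islimpt {z \<in> unit_disk. f z = 0}"
proof -
  let ?w = "\<lambda>n. (affine_symbol a ^^ n) z"
  have "?w n \<in> unit_disk \<and> f (?w n) = 0" for n
  proof (induction n)
    case (Suc n)
    then have "?w n \<noteq> 1"
      by auto
    with Suc show ?case
      using affine_symbol_in_disk[OF a, of "?w n"] inv[of "?w n"] by auto
  qed (use z in simp)
  moreover have "?w \<longlonglongrightarrow> 1 - 0"
  proof -
    have "(\<lambda>n. 1 - of_real a ^ n * (1 - z)) \<longlonglongrightarrow> 1 - 0 * (1 - z)"
      using a by (intro tendsto_intros LIMSEQ_power_zero) auto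
    moreover have "?w n = 1 - of_real a ^ n * (1 - z)" for n
      using one_minus_affine_symbol_funpow[where a = a and n = n and z = z] by (simp add: algebra_simps)
    ultimately show ?thesis
      by simp
  qed
  ultimately show ?thesis
    unfolding islimpt_sequential by (intro exI[of _ ?w]) auto
qed

text \<open>Discards the only boundary point that the symbol does not carry into the open disk, its
  fixed point 1.\<close>

lemma AE_cis_neq_1: "AE t in lborel. cis t \<noteq> 1"
proof -
  have "{t. cis t = 1} \<subseteq> range (\<lambda>n::int. of_int n * 2 * pi)"
    by (auto simp: complex_eq_iff cos_one_2pi_int)
  then have "countable {t. cis t = 1}"
    by (rule countable_subset) auto
  then show ?thesis
    by (intro AE_I'[OF countable_imp_null_set_lborel]) auto
qed

text \<open>Links the Poisson kernel with pole 1 to the exponent of the singular inner function. At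
  z = 1 both sides are 0 because x / 0 = 0.\<close>

lemma Re_cayley: "Re ((1 + z) / (1 - z)) = poisson_kernel z 1"
  unfolding poisson_kernel_def Re_divide cmod_power2
  by (simp add: algebra_simps power2_eq_square)

lemma norm_constant_imp_constant_on:
  fixes f :: "complex \<Rightarrow> complex"
  assumes "f holomorphic_on unit_disk" "\<And>z. z \<in> unit_disk \<Longrightarrow> norm (f z) = c"
  shows "f constant_on unit_disk"
  by (rule maximum_modulus_principle[where \<xi> = 0 and U = unit_disk]) (use assms in auto)

section \<open>Inner functions \<Theta> with \<Theta> H^2 invariant\<close>

context
  fixes a :: real and \<Theta> :: "complex \<Rightarrow> complex"
  assumes a: "0 < a" "a < 1"
    and inner: "inner_function \<Theta>"
    and inv: "invariant_under (composition_op (affine_symbol a)) (mult_hardy2 \<Theta>)"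
begin

text \<open>The constant 1 belongs to \<open>hardy2\<close>, so \<Theta> itself lies in the subspace
  and invariance can be applied to it.\<close>

lemma invariant_quotient:
  obtains g where "g \<in> hardy2" "\<And>z. z \<in> unit_disk \<Longrightarrow> \<Theta> (affine_symbol a z) = \<Theta> z * g z"
proof -
  have one: "(\<lambda>n. (if n = 0 then 1 else 0) * z ^ n) sums 1" for z :: complex
    using sums_single[of 0 "\<lambda>n. z ^ n"] by (simp add: if_distrib[of "\<lambda>x. x * _"] cong: if_cong)
  have "summable (\<lambda>n::nat. (norm (if n = 0 then 1 else 0 :: complex))\<^sup>2)"
    by (rule summable_finite[of "{0}"]) auto
  then have "(\<lambda>_. 1) \<in> hardy2"
    unfolding hardy2_def by (intro CollectI exI[of _ "\<lambda>n. if n = 0 then 1 else 0"] conjI ballI one)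
  then have "\<Theta> \<in> mult_hardy2 \<Theta>"
    unfolding mult_hardy2_def by force
  then have "composition_op (affine_symbol a) \<Theta> \<in> mult_hardy2 \<Theta>"
    using inv unfolding invariant_under_def by blast
  then show thesis
    using that unfolding mult_hardy2_def composition_op_def by auto
qed

lemma inner_hardy2: "\<Theta> \<in> hardy2"
  using inner by (simp add: inner_function_def)

lemma inner_radial_limit:
  "AE t in lborel. t \<in> {0..2 * pi} \<longrightarrow>
     ((\<lambda>r::real. norm (\<Theta> (of_real r * cis t))) \<longlongrightarrow> 1) (at_left 1)"
  using conjunct2[OF inner[unfolded inner_function_def]]
  by eventually_elim (metis tendsto_norm)

lemma inner_norm_le_1: "z \<in> unit_disk \<Longrightarrow> norm (\<Theta> z) \<le> 1"
  by (rule hardy2_norm_le_1[OF inner_hardy2]) (use inner_radial_limit in eventually_elim, auto)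

text \<open>
  The radial limits of the quotient have modulus at most 1, because the symbol
  maps the punctured circle into the open disk, where the inner function is continuous.
\<close>
lemma norm_inner_affine_symbol_le:
  assumes z: "z \<in> unit_disk"
  shows "norm (\<Theta> (affine_symbol a z)) \<le> norm (\<Theta> z)"
proof -
  obtain g where g: "g \<in> hardy2"
    and \<Theta>g: "\<And>z. z \<in> unit_disk \<Longrightarrow> \<Theta> (affine_symbol a z) = \<Theta> z * g z"
    using invariant_quotient by blast
  have "norm (g z) \<le> 1"
  proof (rule hardy2_norm_le_1[OF g _ z])
    show "AE t in lborel. t \<in> {0..2 * pi} \<longrightarrow>
        (\<exists>l\<le>1. ((\<lambda>r::real. norm (g (of_real r * cis t))) \<longlongrightarrow> l) (at_left 1))"
      using inner_radial_limit AE_cis_neq_1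
    proof eventually_elim
      case (elim t)
      show ?case
      proof (intro impI exI conjI)
        assume "t \<in> {0..2 * pi}"
        then have lim: "((\<lambda>r::real. norm (\<Theta> (of_real r * cis t))) \<longlongrightarrow> 1) (at_left 1)"
          using elim by blast
        have in_disk: "affine_symbol a (cis t) \<in> unit_disk"
          using elim by (intro affine_symbol_in_disk a) auto
        then show "norm (\<Theta> (affine_symbol a (cis t))) \<le> 1"
          by (rule inner_norm_le_1)
        have "isCont \<Theta> (affine_symbol a (cis t))"
          using in_disk hardy2_holomorphic[OF inner_hardy2]
          by (meson continuous_on_eq_continuous_at holomorphic_on_imp_continuous_on open_ball)
        moreover have "((\<lambda>r::real. affine_symbol a (of_real r * cis t)) \<longlongrightarrow> affine_symbol a (of_real 1 * cis t)) (at_left 1)"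
          unfolding affine_symbol_def by (intro tendsto_intros)
        ultimately have "((\<lambda>r::real. \<Theta> (affine_symbol a (of_real r * cis t))) \<longlongrightarrow> \<Theta> (affine_symbol a (cis t))) (at_left 1)"
          using isCont_tendsto_compose by fastforce
        then have "((\<lambda>r::real. norm (\<Theta> (affine_symbol a (of_real r * cis t))) / norm (\<Theta> (of_real r * cis t)))
            \<longlongrightarrow> norm (\<Theta> (affine_symbol a (cis t))) / 1) (at_left 1)"
          by (intro tendsto_intros lim) auto
        \<comment> \<open>Division by \<Theta> is needed only near the end of the radius, where its
          modulus is close to 1, so zeros elsewhere in the disk do no harm.\<close>
        moreover have "\<forall>\<^sub>F r in at_left 1. norm (\<Theta> (affine_symbol a (of_real r * cis t))) / norm (\<Theta> (of_real r * cis t))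
            = norm (g (of_real r * cis t))"
        proof -
          have "\<forall>\<^sub>F r in at_left 1. r \<in> {0<..<1::real}"
            by (rule eventually_at_leftI[of 0]) auto
          moreover have "\<forall>\<^sub>F r in at_left 1. 0 < norm (\<Theta> (of_real r * cis t))"
            using lim by (rule order_tendstoD) simp
          ultimately show ?thesis
            by eventually_elim (simp add: \<Theta>g norm_mult)
        qed
        ultimately show "((\<lambda>r::real. norm (g (of_real r * cis t))) \<longlongrightarrow> norm (\<Theta> (affine_symbol a (cis t)))) (at_left 1)"
          by (simp add: filterlim_cong)
      qed
    qed
  qed
  then show ?thesis
    using \<Theta>g[OF z] by (simp add: norm_mult mult_left_le)
qed

text \<open>A holomorphic logarithm makes - ln |\<Theta>| the real part of \<open>h\<close>, to
  which \<open>vanishing_off_1_imp_poisson_kernel\<close> applies. This determines |\<Theta>|, and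
  the remaining factor has modulus 1, hence is constant. The value K = 0 is still allowed here and
  corresponds to a constant \<Theta>.\<close>

lemma zero_free_imp_singular:
  assumes nz: "\<And>z. z \<in> unit_disk \<Longrightarrow> \<Theta> z \<noteq> 0"
  obtains K c where "0 \<le> K" "norm c = 1"
    "\<And>z. z \<in> unit_disk \<Longrightarrow> \<Theta> z = c * exp (- of_real K * ((1 + z) / (1 - z)))"
proof -
  note hol = hardy2_holomorphic[OF inner_hardy2]
  obtain k where k: "k holomorphic_on unit_disk" "\<And>z. z \<in> unit_disk \<Longrightarrow> \<Theta> z = exp (k z)"
    using contractible_imp_holomorphic_log[OF hol convex_imp_contractible nz] by (metis convex_ball)
  define h where "h z = - k z" for z
  have h: "h holomorphic_on unit_disk"
    unfolding h_def by (intro holomorphic_intros k)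
  have u: "norm (\<Theta> z) = exp (- Re (h z))" if "z \<in> unit_disk" for z
    using k(2)[OF that] by (simp add: h_def)
  have nonneg: "0 \<le> Re (h z)" if "z \<in> unit_disk" for z
    using inner_norm_le_1[OF that] u[OF that] by simp
  have mono: "Re (h z) \<le> Re (h (affine_symbol a z))" if z: "z \<in> unit_disk" for z
  proof -
    have "affine_symbol a z \<in> unit_disk"
      using z by (intro affine_symbol_in_disk a) auto
    then show ?thesis
      using norm_inner_affine_symbol_le[OF z] u z by simp
  qed
  have Re_h: "Re (h z) = Re (h 0) * poisson_kernel z 1" if "z \<in> unit_disk" for z
  proof (rule vanishing_off_1_imp_poisson_kernel[OF h that nonneg])
    fix \<delta> :: real
    assume "0 < \<delta>"
    \<comment> \<open>A compact set that includes boundary points but not 1. The symbol maps it into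
      the open disk, so Re h after the symbol is bounded on it, and \<open>mono\<close> passes this
      bound to Re h.\<close>
    let ?S = "cball 0 1 - ball 1 \<delta> :: complex set"
    have "compact ((\<lambda>z. Re (h (affine_symbol a z))) ` ?S)"
    proof (rule compact_continuous_image)
      have "affine_symbol a ` ?S \<subseteq> unit_disk"
        using \<open>0 < \<delta>\<close> by (auto intro!: affine_symbol_in_disk a simp del: mem_ball_0)
      moreover have "continuous_on ?S (affine_symbol a)"
        unfolding affine_symbol_def by (intro continuous_intros)
      ultimately show "continuous_on ?S (\<lambda>z. Re (h (affine_symbol a z)))"
        by (intro continuous_on_Re continuous_on_compose2[OF holomorphic_on_imp_continuous_on[OF h]])
    qed (intro compact_diff compact_cball open_ball)
    then obtain B where B: "\<And>w. w \<in> ?S \<Longrightarrow> Re (h (affine_symbol a w)) \<le> B"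
      by (meson bdd_above.E bounded_imp_bdd_above compact_imp_bounded imageI)
    show "\<exists>B. \<forall>w\<in>unit_disk. \<delta> \<le> norm (w - 1) \<longrightarrow> Re (h w) \<le> B"
    proof (intro exI ballI impI)
      fix w assume w: "w \<in> unit_disk" "\<delta> \<le> norm (w - 1)"
      then have "w \<in> ?S"
        by (auto simp: dist_norm norm_minus_commute)
      then show "Re (h w) \<le> B"
        using B mono[OF w(1)] by force
    qed
  next
    show "AE t in lborel. t \<in> {0..2 * pi} \<longrightarrow>
        ((\<lambda>r::real. Re (h (of_real r * cis t))) \<longlongrightarrow> 0) (at_left 1)"
      using inner_radial_limit
    proof eventually_elim
      case (elim t)
      show ?case
      proof
        assume "t \<in> {0..2 * pi}"
        then have "((\<lambda>r::real. - ln (norm (\<Theta> (of_real r * cis t)))) \<longlongrightarrow> - ln 1) (at_left 1)"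
          using elim by (intro tendsto_intros) auto
        moreover have "\<forall>\<^sub>F r in at_left 1. - ln (norm (\<Theta> (of_real r * cis t))) = Re (h (of_real r * cis t))"
        proof -
          have "\<forall>\<^sub>F r in at_left 1. r \<in> {0<..<1::real}"
            by (rule eventually_at_leftI[of 0]) auto
          then show ?thesis
            by eventually_elim (simp add: u)
        qed
        ultimately show "((\<lambda>r::real. Re (h (of_real r * cis t))) \<longlongrightarrow> 0) (at_left 1)"
          by (simp add: filterlim_cong)
      qed
    qed
  qed
  define K where "K = Re (h 0)"
  define E where "E z = of_real K * ((1 + z) / (1 - z))" for z :: complex
  have "(\<lambda>z. \<Theta> z * exp (E z)) constant_on unit_disk"
  proof (rule norm_constant_imp_constant_on)
    show "(\<lambda>z. \<Theta> z * exp (E z)) holomorphic_on unit_disk"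
      unfolding E_def by (intro holomorphic_intros hol) auto
    show "norm (\<Theta> z * exp (E z)) = 1" if "z \<in> unit_disk" for z
    proof -
      have "Re (E z) = K * poisson_kernel z 1"
        unfolding E_def by (simp only: Re_cayley Re_complex_of_real Im_complex_of_real times_complex.simps)
      then show ?thesis
        using u[OF that] Re_h[OF that] by (simp add: norm_mult K_def flip: exp_add)
    qed
  qed
  then obtain c where c: "\<And>z. z \<in> unit_disk \<Longrightarrow> \<Theta> z * exp (E z) = c"
    unfolding constant_on_def by blast
  show thesis
  proof (rule that)
    show "0 \<le> K"
      using nonneg[of 0] by (simp add: K_def)
    have "norm (\<Theta> 0 * exp (E 0)) = 1"
      using u[of 0] by (simp add: E_def norm_mult K_def flip: exp_add)
    then show "norm c = 1"
      using c[of 0] by simp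
    show "\<Theta> z = c * exp (- of_real K * ((1 + z) / (1 - z)))" if "z \<in> unit_disk" for z
    proof -
      have "\<Theta> z = c * exp (- E z)"
        by (simp add: exp_minus flip: c[OF that])
      then show ?thesis
        by (simp add: E_def)
    qed
  qed
qed

end

section \<open>The dichotomy\<close>

theorem theorem18:
  fixes a :: real and \<Theta> :: "complex \<Rightarrow> complex"
  assumes "0 < a" and "a < 1"
    and "inner_function \<Theta>"
    and "\<not> \<Theta> constant_on unit_disk"
    and "invariant_under (composition_op (affine_symbol a)) (mult_hardy2 \<Theta>)"
  shows "(\<exists>(K::real) (c::complex). K > 0 \<and> norm c = 1 \<and>
            (\<forall>z\<in>unit_disk. \<Theta> z = c * exp (- of_real K * ((1 + z) / (1 - z)))))
         \<noteq> (infinite {z \<in> unit_disk. \<Theta> z = 0} \<and> 1 islimpt {z \<in> unit_disk. \<Theta> z = 0})"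
proof (cases "\<exists>z\<in>unit_disk. \<Theta> z = 0")
  \<comment> \<open>One zero decides between the alternatives: its orbit gives zeros accumulating at
    1, while the exponential in (i) never vanishes.\<close>
  case True
  then obtain z where z: "z \<in> unit_disk" "\<Theta> z = 0"
    by blast
  have "\<Theta> (affine_symbol a w) = 0" if "w \<in> unit_disk" "\<Theta> w = 0" for w
    using norm_inner_affine_symbol_le[OF assms(1,2,3,5) that(1)] that(2) by simp
  then have "1 islimpt {z \<in> unit_disk. \<Theta> z = 0}"
    using islimpt_zeros[of a \<Theta>, OF assms(1,2) _ z] by blast
  moreover from this have "infinite {z \<in> unit_disk. \<Theta> z = 0}"
    using islimpt_finite by blast
  moreover have "\<not> (\<exists>(K::real) (c::complex). K > 0 \<and> norm c = 1 \<and>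
      (\<forall>z\<in>unit_disk. \<Theta> z = c * exp (- of_real K * ((1 + z) / (1 - z)))))"
    using z by force
  ultimately show ?thesis
    by blast
next
  case False
  then obtain K c where Kc: "0 \<le> K" "norm c = 1"
    "\<And>z. z \<in> unit_disk \<Longrightarrow> \<Theta> z = c * exp (- of_real K * ((1 + z) / (1 - z)))"
    using zero_free_imp_singular[OF assms(1,2,3,5)] by blast
  have "K \<noteq> 0"
  proof
    assume "K = 0"
    then have "\<Theta> constant_on unit_disk"
      using Kc(3) unfolding constant_on_def by auto
    then show False
      using assms(4) by blast
  qed
  then have "K > 0"
    using Kc(1) by simp
  moreover have "{z \<in> unit_disk. \<Theta> z = 0} = {}"
    using False by blast
  ultimately show ?thesis
    using Kc(2,3) by (metis finite.emptyI)
qed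

end
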